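(* Let $M : \mathbf{R}^n \to \mathbf{vec}$ be finitely presentable. Then the function $\mathsf{Hil}(M)$ admits a minimal Hilbert decomposition $(P^*,Q^* )$ and, for every other minimal Hilbert decomposition $(P,Q)$ of $\mathsf{Hil}(M)$, we have $P \cong P^*$ and $Q \cong Q^*$.
   Context: Fix a field $\mathbb{k}$ and $n\in\mathbb{N}$. $\mathbf{vec}$ is the category of finite-dimensional $\mathbb{k}$-vector spaces. $\mathbf{R}^n$ is the set $\mathbb{R}^n$ with the product order, viewed as a category. An $n$-parameter persistence module is a functor $\mathbf{R}^n \to \mathbf{vec}$. For $i \in \mathbb{R}^n$, $F_i$ is the module that is $\mathbb{k}$ on $\{j : j \geq i\}$ and $0$ elsewhere, with identity structure maps inside the support. A module is free if it is isomorphic to a direct sum of modules $F_i$; the barcode $\mathcal{B}(P)$ of a free module is the unique multiset of elements of $\mathbb{R}^n$ with $P \cong \bigoplus_{i \in \mathcal{B}(P)} F_i$, and its cardinality is the rank of $P$. A module is finitely presentable if it is isomorphic to the cokernel of a morphism between free modules of finite rank. The Hilbert function of $M$ is $\mathsf{Hil}(M) : \mathbb{R}^n \to \mathbb{Z}$, $i\mapsto \dim M(i)$. A (finite) Hilbert decomposition of a function $\eta : \mathbb{R}^n \to \mathbb{Z}$ is a pair $(P,Q)$ of free modules of finite rank with $\eta = \mathsf{Hil}(P) - \mathsf{Hil}(Q)$; it is minimal if $\mathcal{B}(P)$ and $\mathcal{B}(Q)$ are disjoint as multisets (no common element of $\mathbb{R}^n$). *)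

theory Defs
  imports
    Complex_Main
    "HOL-Library.FuncSet"
    "HOL-Library.Multiset"
    "HOL-Library.Function_Algebras"
    "HOL-Library.Set_Algebras"
begin

text \<open>
  The points of \<open>R^n\<close> are the real functions on \<open>{..<n}\<close> that are undefined outside, so that
  \<open>n\<close> is an arbitrary natural number.  On this set the pointwise order of functions is the
  product order.
\<close>

definition Rn :: "nat \<Rightarrow> (nat \<Rightarrow> real) set" where
  "Rn n = {..<n} \<rightarrow>\<^sub>E UNIV"

text \<open>
  A functor from a subset \<open>I\<close> of an ordered type to vector spaces.  All its values are subspaces of
  one ambient vector space \<open>('v, scl M)\<close> of any dimension; \<open>tr M i j\<close> is the structure map
  \<open>M(i) \<rightarrow> M(j)\<close> for \<open>i \<le> j\<close>.  Only \<open>spc M i\<close> with \<open>i \<in> I\<close>, and the values of \<open>tr M i j\<close> on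
  \<open>spc M i\<close> for \<open>i \<le> j\<close> in \<open>I\<close>, carry meaning.
\<close>

record ('p, 'k, 'v) pmod =
  scl :: "'k \<Rightarrow> 'v \<Rightarrow> 'v"
  spc :: "'p \<Rightarrow> 'v set"
  tr :: "'p \<Rightarrow> 'p \<Rightarrow> 'v \<Rightarrow> 'v"

definition linear_between ::
    "('k::field \<Rightarrow> 'v::ab_group_add \<Rightarrow> 'v) \<Rightarrow> ('k \<Rightarrow> 'w::ab_group_add \<Rightarrow> 'w) \<Rightarrow>
      'v set \<Rightarrow> 'w set \<Rightarrow> ('v \<Rightarrow> 'w) \<Rightarrow> bool" where
  "linear_between s t V W f \<longleftrightarrow>
    f ` V \<subseteq> W \<and>
    (\<forall>x\<in>V. \<forall>y\<in>V. f (x + y) = f x + f y) \<and>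
    (\<forall>c. \<forall>x\<in>V. f (s c x) = t c (f x))"

definition fin_dim :: "('k::field \<Rightarrow> 'v::ab_group_add \<Rightarrow> 'v) \<Rightarrow> 'v set \<Rightarrow> bool" where
  "fin_dim s V \<longleftrightarrow> (\<exists>B. finite B \<and> module.span s B = V)"

definition pers_module ::
    "'p::order set \<Rightarrow> ('p, 'k::field, 'v::ab_group_add) pmod \<Rightarrow> bool" where
  "pers_module I M \<longleftrightarrow>
    vector_space (scl M) \<and>
    (\<forall>i\<in>I. module.subspace (scl M) (spc M i) \<and> fin_dim (scl M) (spc M i)) \<and>
    (\<forall>i\<in>I. \<forall>j\<in>I. i \<le> j \<longrightarrow>
      linear_between (scl M) (scl M) (spc M i) (spc M j) (tr M i j)) \<and>
    (\<forall>i\<in>I. \<forall>x\<in>spc M i. tr M i i x = x) \<and>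
    (\<forall>i\<in>I. \<forall>j\<in>I. \<forall>l\<in>I. i \<le> j \<longrightarrow> j \<le> l \<longrightarrow>
      (\<forall>x\<in>spc M i. tr M i l x = tr M j l (tr M i j x)))"

definition pers_hom ::
    "'p::order set \<Rightarrow> ('p, 'k::field, 'v::ab_group_add) pmod \<Rightarrow>
      ('p, 'k, 'w::ab_group_add) pmod \<Rightarrow> ('p \<Rightarrow> 'v \<Rightarrow> 'w) \<Rightarrow> bool" where
  "pers_hom I M N f \<longleftrightarrow>
    (\<forall>i\<in>I. linear_between (scl M) (scl N) (spc M i) (spc N i) (f i)) \<and>
    (\<forall>i\<in>I. \<forall>j\<in>I. i \<le> j \<longrightarrow>
      (\<forall>x\<in>spc M i. f j (tr M i j x) = tr N i j (f i x)))"

definition pers_iso ::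
    "'p::order set \<Rightarrow> ('p, 'k::field, 'v::ab_group_add) pmod \<Rightarrow>
      ('p, 'k, 'w::ab_group_add) pmod \<Rightarrow> bool" where
  "pers_iso I M N \<longleftrightarrow>
    (\<exists>f g. pers_hom I M N f \<and> pers_hom I N M g \<and>
      (\<forall>i\<in>I. (\<forall>x\<in>spc M i. g i (f i x) = x) \<and> (\<forall>y\<in>spc N i. f i (g i y) = y)))"

text \<open>The module \<open>F\<^sub>i\<close>, with values \<open>UNIV\<close> and \<open>{0}\<close> in the field.\<close>

definition free_rank1 :: "'p::order \<Rightarrow> ('p, 'k::field, 'k) pmod" where
  "free_rank1 i = \<lparr>
    scl = (*),
    spc = (\<lambda>j. if i \<le> j then UNIV else {0}),
    tr = (\<lambda>j l x. if i \<le> j then x else 0)\<rparr>"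

text \<open>
  Elements of the direct sum are the finitely supported families, extended by \<open>0\<close> outside the index
  set \<open>X\<close>.  The family \<open>N\<close> is total: the scalar multiplications \<open>scl (N x)\<close> with \<open>x \<notin> X\<close> are part of
  the ambient vector space and must satisfy the vector space axioms as well.
\<close>

definition direct_sum ::
    "'x set \<Rightarrow> ('x \<Rightarrow> ('p, 'k::field, 'v::ab_group_add) pmod) \<Rightarrow> ('p, 'k, 'x \<Rightarrow> 'v) pmod" where
  "direct_sum X N = \<lparr>
    scl = (\<lambda>c f x. scl (N x) c (f x)),
    spc = (\<lambda>i. {f. (\<forall>x\<in>X. f x \<in> spc (N x) i) \<and> (\<forall>x. x \<notin> X \<longrightarrow> f x = 0) \<and>
      finite {x. f x \<noteq> 0}}),
    tr = (\<lambda>i j f x. if x \<in> X then tr (N x) i j (f x) else 0)\<rparr>"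

text \<open>
  The direct sum of the modules \<open>F\<^sub>b\<close> over a finite multiset: the summands are indexed by the pairs
  \<open>(b, m)\<close> with \<open>m < count B b\<close>.
\<close>

definition free_module :: "'p::order multiset \<Rightarrow> ('p, 'k::field, 'p \<times> nat \<Rightarrow> 'k) pmod" where
  "free_module B = direct_sum {(b, m). m < count B b} (\<lambda>(b, m). free_rank1 b)"

definition is_barcode ::
    "'p::order set \<Rightarrow> ('p, 'k::field, 'v::ab_group_add) pmod \<Rightarrow> 'p multiset \<Rightarrow> bool" where
  "is_barcode I P B \<longleftrightarrow>
    set_mset B \<subseteq> I \<and> pers_iso I P (free_module B :: ('p, 'k, 'p \<times> nat \<Rightarrow> 'k) pmod)"

definition free_fin_rank ::
    "'p::order set \<Rightarrow> ('p, 'k::field, 'v::ab_group_add) pmod \<Rightarrow> bool" where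
  "free_fin_rank I P \<longleftrightarrow> pers_module I P \<and> (\<exists>B. is_barcode I P B)"

definition barcode ::
    "'p::order set \<Rightarrow> ('p, 'k::field, 'v::ab_group_add) pmod \<Rightarrow> 'p multiset" where
  "barcode I P = (THE B. is_barcode I P B)"

text \<open>
  \<open>M\<close> is isomorphic to the cokernel of \<open>f : P \<rightarrow> N\<close>.  The cokernel at \<open>i\<close> is the quotient
  \<open>N(i) / W i\<close> by the image \<open>W i\<close> of \<open>f i\<close>, its elements are the cosets \<open>x +o W i\<close>, and its
  operations and structure maps are those of \<open>N\<close> on representatives; \<open>\<theta>\<close> is the isomorphism.
\<close>

definition iso_to_coker ::
    "'p::order set \<Rightarrow> ('p, 'k::field, 'v::ab_group_add) pmod \<Rightarrow>
      ('p, 'k, 'w::ab_group_add) pmod \<Rightarrow> ('p, 'k, 'u::ab_group_add) pmod \<Rightarrow>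
      ('p \<Rightarrow> 'w \<Rightarrow> 'u) \<Rightarrow> bool" where
  "iso_to_coker I M P N f \<longleftrightarrow>
    (let W = (\<lambda>i. f i ` spc P i) in
      \<exists>\<theta> :: 'p \<Rightarrow> 'u set \<Rightarrow> 'v.
        (\<forall>i\<in>I.
          bij_betw (\<theta> i) {x +o W i |x. x \<in> spc N i} (spc M i) \<and>
          (\<forall>x\<in>spc N i. \<forall>y\<in>spc N i.
            \<theta> i ((x + y) +o W i) = \<theta> i (x +o W i) + \<theta> i (y +o W i)) \<and>
          (\<forall>c. \<forall>x\<in>spc N i. \<theta> i (scl N c x +o W i) = scl M c (\<theta> i (x +o W i)))) \<and>
        (\<forall>i\<in>I. \<forall>j\<in>I. i \<le> j \<longrightarrow>
          (\<forall>x\<in>spc N i. \<theta> j (tr N i j x +o W j) = tr M i j (\<theta> i (x +o W i)))))"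

text \<open>
  The type of \<open>P\<close> and \<open>N\<close> is no restriction: it contains \<open>free_module B\<close> for every \<open>B\<close>, hence an
  isomorphic copy of every free module of finite rank.
\<close>

definition finitely_presentable ::
    "'p::order set \<Rightarrow> ('p, 'k::field, 'v::ab_group_add) pmod \<Rightarrow> bool" where
  "finitely_presentable I M \<longleftrightarrow>
    (\<exists>(P :: ('p, 'k, 'p \<times> nat \<Rightarrow> 'k) pmod) (N :: ('p, 'k, 'p \<times> nat \<Rightarrow> 'k) pmod) f.
      free_fin_rank I P \<and> free_fin_rank I N \<and> pers_hom I P N f \<and> iso_to_coker I M P N f)"

definition Hil :: "('p, 'k::field, 'v::ab_group_add) pmod \<Rightarrow> 'p \<Rightarrow> int" where
  "Hil M i = int (vector_space.dim (scl M) (spc M i))"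

definition hilbert_decomposition ::
    "'p::order set \<Rightarrow> ('p \<Rightarrow> int) \<Rightarrow> ('p, 'k::field, 'v::ab_group_add) pmod \<Rightarrow>
      ('p, 'k, 'w::ab_group_add) pmod \<Rightarrow> bool" where
  "hilbert_decomposition I \<eta> P Q \<longleftrightarrow>
    free_fin_rank I P \<and> free_fin_rank I Q \<and> (\<forall>i\<in>I. \<eta> i = Hil P i - Hil Q i)"

definition minimal_hilbert_decomposition ::
    "'p::order set \<Rightarrow> ('p \<Rightarrow> int) \<Rightarrow> ('p, 'k::field, 'v::ab_group_add) pmod \<Rightarrow>
      ('p, 'k, 'w::ab_group_add) pmod \<Rightarrow> bool" where
  "minimal_hilbert_decomposition I \<eta> P Q \<longleftrightarrow>
    hilbert_decomposition I \<eta> P Q \<and> set_mset (barcode I P) \<inter> set_mset (barcode I Q) = {}"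

end

theory Submission
  imports Defs
begin

text \<open>
  The Hilbert function of a free module with finite barcode \<open>B\<close> counts, at \<open>i\<close>, the elements of \<open>B\<close>
  below \<open>i\<close>, and this counting function determines \<open>B\<close>: at a minimal point where two multisets
  differ, their counting functions differ as well (lemma \<open>count_below_inject\<close>).  Uniqueness follows.
  Two minimal decompositions satisfy \<open>\<B>(P) + \<B>(Q\<^sup>*) = \<B>(P\<^sup>*) + \<B>(Q)\<close>, and disjointness of the
  barcodes in each pair leaves only \<open>\<B>(P) = \<B>(P\<^sup>*)\<close> and \<open>\<B>(Q) = \<B>(Q\<^sup>*)\<close>
  (lemma \<open>disjoint_mset_cancel\<close>).

  For existence, present \<open>M\<close> as the cokernel of a morphism between free
  modules, and let \<open>S\<close> be the finite set of degrees in their barcodes.  If \<open>i \<le> j\<close> have the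
  same elements of \<open>S\<close> below them, then the structure maps from \<open>i\<close> to \<open>j\<close> of both free modules are
  bijective, hence so is that of \<open>M\<close> (lemma \<open>coker_tr_bij\<close>).  The value \<open>Hil M i\<close> is therefore the one at
  the join of the elements of \<open>S\<close> below \<open>i\<close>, and it is \<open>0\<close> if there are none.  So \<open>Hil M\<close> is
  determined by its values on the finite set \<open>T\<close> of joins of nonempty subsets of \<open>S\<close>, and Moebius
  inversion on \<open>T\<close> writes it as \<open>i \<mapsto> (\<Sum>t | t \<in> T \<and> t \<le> i. c t)\<close> with integers \<open>c t\<close>.  The positive
  and the negative parts of \<open>c\<close> are the two barcodes.

  Joins are what makes this work: the result holds over every index set \<open>I\<close> that is closed under
  binary joins in its ordered type, and \<open>R\<^sup>n\<close> is such a set.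
\<close>

section \<open>Linear bijections and dimension\<close>

lemma dim_eq_of_linear_bij:
  assumes s: "vector_space s" and t: "vector_space t"
    and V: "module.subspace s V" and f: "linear_between s t V W f" and bij: "bij_betw f V W"
  shows "vector_space.dim s V = vector_space.dim t W"
proof -
  interpret vector_space_pair s t
    using s t by (simp add: vector_space_pair_def)
  obtain B where B: "B \<subseteq> V" "vs1.independent B" "V \<subseteq> vs1.span B" "card B = vs1.dim V"
    by (rule vs1.basis_exists)
  have span: "vs1.span B = V"
    using B V vs1.span_minimal by blast
  \<comment> \<open>The map \<open>f\<close> is linear on \<open>V\<close> only; extend it to a linear map \<open>g\<close> of the ambient spaces.\<close>
  obtain g where g: "Vector_Spaces.linear s t g" "\<And>x. x \<in> B \<Longrightarrow> g x = f x"
    using linear_independent_extend[OF B(2), of f] by blast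
  interpret g: Vector_Spaces.linear s t g by (rule g(1))
  have add: "f (x + y) = f x + f y" and scale: "f (s c x) = t c (f x)" if "x \<in> V" "y \<in> V" for c x y
    using f that unfolding linear_between_def by auto
  have f0: "f 0 = 0"
    using add[of 0 0] vs1.subspace_0[OF V] by simp
  have gf: "g x = f x" if "x \<in> V" for x
  proof -
    have "x \<in> vs1.span B" using that span by simp
    then have "x \<in> V \<and> g x = f x"
    proof (induction rule: vs1.span_induct_alt)
      case base
      then show ?case using f0 vs1.subspace_0[OF V] by (simp add: g.zero)
    next
      case (step c x y)
      have x: "x \<in> V" using step B(1) by blast
      then have cx: "s c x \<in> V" by (rule vs1.subspace_scale[OF V])
      have "g (s c x + y) = f (s c x + y)"
        using step g(2)[OF \<open>x \<in> B\<close>] add[OF cx, of y] scale[OF x x] by (simp add: g.add g.scale)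
      then show ?case using step vs1.subspace_add[OF V cx] by simp
    qed
    then show ?thesis by simp
  qed
  have inj: "inj_on g V" and im: "g ` V = W"
    using bij gf by (auto simp: bij_betw_def inj_on_def)
  have "vs2.independent (g ` B)"
    using linear_independent_injective_image[OF g(1) B(2)] inj span by simp
  moreover have "vs2.span (g ` B) = W"
    using g.span_image[of B] span im by simp
  ultimately have "vs2.dim W = card (g ` B)"
    using vs2.dim_span_eq_card_independent by metis
  also have "\<dots> = card B"
    using inj B(1) by (meson card_image inj_on_subset)
  finally show ?thesis using B(4) by simp
qed

lemma pers_moduleD:
  assumes "pers_module I M"
  shows "vector_space (scl M)"
    and "i \<in> I \<Longrightarrow> module.subspace (scl M) (spc M i)"
    and "i \<in> I \<Longrightarrow> j \<in> I \<Longrightarrow> i \<le> j \<Longrightarrow>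
      linear_between (scl M) (scl M) (spc M i) (spc M j) (tr M i j)"
proof -
  note M = assms[unfolded pers_module_def]
  show "vector_space (scl M)" by (rule conjunct1[OF M])
  show "i \<in> I \<Longrightarrow> module.subspace (scl M) (spc M i)"
    using conjunct1[OF conjunct2[OF M]] by simp
  show "i \<in> I \<Longrightarrow> j \<in> I \<Longrightarrow> i \<le> j \<Longrightarrow>
      linear_between (scl M) (scl M) (spc M i) (spc M j) (tr M i j)"
    using conjunct1[OF conjunct2[OF conjunct2[OF M]]] by simp
qed

lemma pers_homD:
  assumes "pers_hom I M N f"
  shows "i \<in> I \<Longrightarrow> linear_between (scl M) (scl N) (spc M i) (spc N i) (f i)"
    and "i \<in> I \<Longrightarrow> x \<in> spc M i \<Longrightarrow> f i x \<in> spc N i"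
    and "i \<in> I \<Longrightarrow> j \<in> I \<Longrightarrow> i \<le> j \<Longrightarrow> x \<in> spc M i \<Longrightarrow> f j (tr M i j x) = tr N i j (f i x)"
proof -
  note f = assms[unfolded pers_hom_def]
  show lin: "i \<in> I \<Longrightarrow> linear_between (scl M) (scl N) (spc M i) (spc N i) (f i)"
    using conjunct1[OF f] by simp
  then show "i \<in> I \<Longrightarrow> x \<in> spc M i \<Longrightarrow> f i x \<in> spc N i"
    by (auto simp: linear_between_def)
  show "i \<in> I \<Longrightarrow> j \<in> I \<Longrightarrow> i \<le> j \<Longrightarrow> x \<in> spc M i \<Longrightarrow> f j (tr M i j x) = tr N i j (f i x)"
    using conjunct2[OF f] by simp
qed

lemma Hil_iso:
  assumes M: "pers_module I M" and N: "vector_space (scl N)" and iso: "pers_iso I M N" and i: "i \<in> I"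
  shows "Hil M i = Hil N i"
proof -
  obtain f g where fg: "pers_hom I M N f" "pers_hom I N M g"
    "\<And>i x. i \<in> I \<Longrightarrow> x \<in> spc M i \<Longrightarrow> g i (f i x) = x"
    "\<And>i y. i \<in> I \<Longrightarrow> y \<in> spc N i \<Longrightarrow> f i (g i y) = y"
    using iso unfolding pers_iso_def by blast
  have "bij_betw (f i) (spc M i) (spc N i)"
    by (rule bij_betw_byWitness[where f' = "g i"])
      (use fg(3,4) i pers_homD(2)[OF fg(1) i] pers_homD(2)[OF fg(2) i] in auto)
  then have "vector_space.dim (scl M) (spc M i) = vector_space.dim (scl N) (spc N i)"
    by (rule dim_eq_of_linear_bij[OF pers_moduleD(1)[OF M] N pers_moduleD(2)[OF M i]
          pers_homD(1)[OF fg(1) i]])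
  then show ?thesis by (simp add: Hil_def)
qed

lemma pers_iso_refl: "pers_iso I M M"
proof -
  have "pers_hom I M M (\<lambda>i x. x)"
    by (auto simp: pers_hom_def linear_between_def)
  then show ?thesis unfolding pers_iso_def by blast
qed

section \<open>Free modules of finite rank\<close>

definition count_below :: "'p::order multiset \<Rightarrow> 'p \<Rightarrow> nat" where
  "count_below B i = size (filter_mset (\<lambda>b. b \<le> i) B)"

text \<open>
  At \<open>i\<close>, exactly these summands of \<open>free_module B\<close> are nonzero, so the value there is the space of all
  families supported on this set.
\<close>

definition live :: "'p::order multiset \<Rightarrow> 'p \<Rightarrow> ('p \<times> nat) set" where
  "live B i = {(b, m). m < count B b \<and> b \<le> i}"

lemma live_eq_Sigma: "live B i = (SIGMA b:set_mset (filter_mset (\<lambda>b. b \<le> i) B). {..<count B b})"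
  by (auto simp: live_def dest: count_inI) (metis count_inI not_less_zero)

lemma finite_live: "finite (live B i)"
  unfolding live_eq_Sigma by (intro finite_SigmaI) auto

lemma card_live: "card (live B i) = count_below B i"
proof -
  have "card (live B i) = (\<Sum>b\<in>set_mset (filter_mset (\<lambda>b. b \<le> i) B). count B b)"
    unfolding live_eq_Sigma by simp
  also have "\<dots> = (\<Sum>b\<in>set_mset (filter_mset (\<lambda>b. b \<le> i) B). count (filter_mset (\<lambda>b. b \<le> i) B) b)"
    by (intro sum.cong) auto
  finally show ?thesis by (simp add: count_below_def size_multiset_overloaded_eq)
qed

lemma scl_free_module: "scl (free_module B) = (\<lambda>c f x. c * f x)"
  by (auto simp: free_module_def direct_sum_def free_rank1_def fun_eq_iff split: prod.splits)

lemma spc_free_module: "spc (free_module B) i = {f. \<forall>x. x \<notin> live B i \<longrightarrow> f x = 0}"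
proof (rule set_eqI)
  fix f :: "'a \<times> nat \<Rightarrow> 'b"
  have "finite {x. f x \<noteq> 0}" if "\<forall>x. x \<notin> live B i \<longrightarrow> f x = 0"
    by (rule finite_subset[OF _ finite_live[of B i]]) (use that in auto)
  then show "f \<in> spc (free_module B) i \<longleftrightarrow> f \<in> {f. \<forall>x. x \<notin> live B i \<longrightarrow> f x = 0}"
    unfolding free_module_def direct_sum_def free_rank1_def live_def
    by (auto split: prod.splits if_splits)
qed

lemma tr_free_module: "tr (free_module B) i j f = (\<lambda>x. if x \<in> live B i then f x else 0)"
  by (auto simp: free_module_def direct_sum_def free_rank1_def fun_eq_iff live_def split: prod.splits)

lemma tr_free_module_id: "f \<in> spc (free_module B) i \<Longrightarrow> tr (free_module B) i j f = f"
  by (auto simp: tr_free_module spc_free_module fun_eq_iff)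

lemma live_mono: "i \<le> j \<Longrightarrow> live B i \<subseteq> live B j"
  by (auto simp: live_def)

lemma spc_free_module_mono: "i \<le> j \<Longrightarrow> spc (free_module B) i \<subseteq> spc (free_module B) j"
  using live_mono[of i j B] by (auto simp: spc_free_module)

lemma vector_space_fun: "vector_space (\<lambda>(c::'k::field) f (x::'x). c * f x)"
  by unfold_locales (auto simp: fun_eq_iff algebra_simps)

lemma sum_fun_app: "(\<Sum>x\<in>A. F x) y = (\<Sum>x\<in>A. F x y)" for F :: "'x \<Rightarrow> 'y \<Rightarrow> 'k::comm_monoid_add"
  by (induction A rule: infinite_finite_induct) auto

lemma basis_of_finite_support:
  fixes J :: "'x set"
  assumes "finite J"
  defines "s \<equiv> \<lambda>(c::'k::field) f (x::'x). c * f x"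
    and "E \<equiv> (\<lambda>x y. if y = x then 1 else (0::'k)) ` J"
  shows "module.span s E = {f. \<forall>x. x \<notin> J \<longrightarrow> f x = 0}" (is "_ = ?V")
    and "\<not> module.dependent s E" and "card E = card J"
proof -
  interpret vector_space s unfolding s_def by (rule vector_space_fun)
  define e where "e = (\<lambda>x y. if y = (x::'x) then 1 else (0::'k))"
  have E: "E = e ` J" by (simp add: E_def e_def)
  have "inj e"
    by (rule injI) (metis (mono_tags) e_def zero_neq_one)
  then have inj: "inj_on e J" by (rule inj_on_subset) simp
  have expand: "(\<Sum>x\<in>J. s (c x) (e x)) y = (if y \<in> J then c y else 0)" for c y
  proof -
    have "(\<Sum>x\<in>J. s (c x) (e x)) y = (\<Sum>x\<in>J. if y = x then c x else 0)"
      unfolding sum_fun_app by (rule sum.cong) (auto simp: s_def e_def)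
    also have "\<dots> = (if y \<in> J then c y else 0)"
      using assms(1) by (simp add: sum.delta')
    finally show ?thesis .
  qed
  have "subspace ?V"
    unfolding subspace_def by (auto simp: s_def)
  moreover have "E \<subseteq> ?V"
    by (auto simp: E_def)
  ultimately have "span E \<subseteq> ?V" by (simp add: span_minimal)
  moreover have "f \<in> span E" if "f \<in> ?V" for f
  proof -
    have "f = (\<Sum>x\<in>J. s (f x) (e x))"
      by (rule ext, unfold expand[of f]) (use that in auto)
    also have "\<dots> \<in> span E"
      unfolding E by (intro span_sum span_scale span_base) auto
    finally show ?thesis .
  qed
  ultimately show "span E = ?V" by blast
  show "card E = card J"
    unfolding E by (rule card_image[OF inj])
  show "\<not> dependent E"
  proof (rule independent_if_scalars_zero)
    show "finite E" using assms(1) by (simp add: E_def)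
    fix c v assume sum0: "(\<Sum>v\<in>E. s (c v) v) = 0" and "v \<in> E"
    then obtain y where y: "y \<in> J" "v = e y" unfolding E by blast
    have "(\<Sum>x\<in>J. s (c (e x)) (e x)) = 0"
      using sum0 unfolding E by (simp add: sum.reindex[OF inj])
    then show "c v = 0"
      using expand[of "\<lambda>x. c (e x)" y] y by simp
  qed
qed

lemma Hil_free_module:
  "Hil (free_module B :: ('p::order, 'k::field, 'p \<times> nat \<Rightarrow> 'k) pmod) i = int (count_below B i)"
proof -
  let ?s = "\<lambda>(c::'k) f (x::'p \<times> nat). c * f x"
  interpret vector_space ?s by (rule vector_space_fun)
  let ?E = "(\<lambda>x y. if y = x then 1 else (0::'k)) ` live B i"
  have "dim (span ?E) = card (live B i)"
    using basis_of_finite_support(2,3)[OF finite_live[of B i], where 'k = 'k] dim_span_eq_card_independent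
    by metis
  then show ?thesis
    by (simp add: Hil_def scl_free_module spc_free_module card_live
        basis_of_finite_support(1)[OF finite_live, where 'k = 'k])
qed

lemma pers_module_free_module:
  "pers_module I (free_module B :: ('p::order, 'k::field, 'p \<times> nat \<Rightarrow> 'k) pmod)"
proof -
  let ?F = "free_module B :: ('p, 'k, 'p \<times> nat \<Rightarrow> 'k) pmod"
  interpret vector_space "scl ?F" unfolding scl_free_module by (rule vector_space_fun)
  have sub: "subspace (spc ?F i)" for i
    by (auto simp: subspace_def spc_free_module) (simp add: scl_free_module)
  have fin: "fin_dim (scl ?F) (spc ?F i)" for i
    unfolding fin_dim_def
  proof (intro exI conjI)
    show "finite ((\<lambda>x y. if y = x then 1 else (0::'k)) ` live B i)"
      by (simp add: finite_live)
  qed (simp add: scl_free_module spc_free_module basis_of_finite_support(1)[OF finite_live])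
  have lin: "linear_between (scl ?F) (scl ?F) (spc ?F i) (spc ?F j) (tr ?F i j)" if "i \<le> j" for i j
    using spc_free_module_mono[OF that, of B, where 'b = 'k] subspace_add[OF sub[of i]]
      subspace_scale[OF sub[of i]]
    unfolding linear_between_def by (auto simp: tr_free_module_id)
  have comp: "tr ?F i l x = tr ?F j l (tr ?F i j x)" if "i \<le> j" "x \<in> spc ?F i" for i j l x
  proof -
    have "x \<in> spc ?F j" using spc_free_module_mono[OF that(1)] that(2) by blast
    then show ?thesis using that(2) by (simp add: tr_free_module_id)
  qed
  show ?thesis
    unfolding pers_module_def
    by (intro conjI ballI impI vector_space_axioms sub fin lin tr_free_module_id comp)
qed

section \<open>Barcodes are determined by Hilbert functions\<close>

lemma count_below_sum:
  assumes "finite T" "set_mset B \<subseteq> T"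
  shows "count_below B i = (\<Sum>t | t \<in> T \<and> t \<le> i. count B t)"
proof -
  have "count_below B i = (\<Sum>t\<in>set_mset (filter_mset (\<lambda>b. b \<le> i) B). count B t)"
    unfolding count_below_def size_multiset_overloaded_eq by (rule sum.cong) auto
  also have "\<dots> = (\<Sum>t | t \<in> T \<and> t \<le> i. count B t)"
    using assms by (intro sum.mono_neutral_left) (auto simp: not_in_iff)
  finally show ?thesis .
qed

lemma count_below_union: "count_below (A + B) i = count_below A i + count_below B i"
  by (simp add: count_below_def)

text \<open>
  A minimal element among the finitely many points of different multiplicity would itself have
  the same multiplicity, because all points strictly below it contribute equally.
\<close>

lemma count_below_inject:
  assumes I: "set_mset A \<subseteq> I" "set_mset B \<subseteq> I"
    and eq: "\<And>i. i \<in> I \<Longrightarrow> count_below A i = count_below B i"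
  shows "A = B"
proof (rule ccontr)
  let ?T = "set_mset A \<union> set_mset B"
  let ?D = "{i. count A i \<noteq> count B i}"
  assume "A \<noteq> B"
  then have "?D \<noteq> {}" by (auto simp: multiset_eq_iff)
  moreover have D: "?D \<subseteq> ?T" by (auto simp: not_in_iff)
  then have "finite ?D" by (rule finite_subset) auto
  ultimately obtain m where m: "m \<in> ?D" "\<And>b. b \<in> ?D \<Longrightarrow> b \<le> m \<Longrightarrow> m = b"
    using finite_has_minimal[of ?D] by blast
  have mT: "m \<in> ?T" using D m(1) by blast
  let ?U = "{t. t \<in> ?T \<and> t \<le> m}"
  have U: "finite ?U" "m \<in> ?U" using mT by auto
  have "(\<Sum>t\<in>?U. count A t) = (\<Sum>t\<in>?U. count B t)"
    using count_below_sum[of ?T A m] count_below_sum[of ?T B m] eq[of m] mT I by auto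
  moreover have "(\<Sum>t\<in>?U - {m}. count A t) = (\<Sum>t\<in>?U - {m}. count B t)"
    using m(2) by (intro sum.cong) auto
  ultimately have "count A m = count B m"
    using sum.remove[OF U, of "count A"] sum.remove[OF U, of "count B"] by simp
  then show False using m(1) by simp
qed

lemma Hil_barcode:
  fixes P :: "('p::order, 'k::field, 'v::ab_group_add) pmod"
  assumes "pers_module I P" "is_barcode I P B" "i \<in> I"
  shows "Hil P i = int (count_below B i)"
proof -
  have "Hil P i = Hil (free_module B :: ('p, 'k, 'p \<times> nat \<Rightarrow> 'k) pmod) i"
    using assms vector_space_fun by (intro Hil_iso) (auto simp: is_barcode_def scl_free_module)
  then show ?thesis by (simp add: Hil_free_module)
qed

lemma barcode_eq:
  assumes "pers_module I P" "is_barcode I P B"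
  shows "barcode I P = B"
  unfolding barcode_def
proof (rule the_equality)
  fix B' assume B': "is_barcode I P B'"
  have "count_below B' i = count_below B i" if "i \<in> I" for i
    using Hil_barcode[OF assms that] Hil_barcode[OF assms(1) B' that] by simp
  then show "B' = B"
    using assms(2) B' by (intro count_below_inject[of _ I]) (auto simp: is_barcode_def)
qed fact

lemma is_barcode_free_module:
  "set_mset B \<subseteq> I \<Longrightarrow>
    is_barcode I (free_module B :: ('p::order, 'k::field, 'p \<times> nat \<Rightarrow> 'k) pmod) B"
  by (simp add: is_barcode_def pers_iso_refl)

lemma free_fin_rank_free_module:
  "set_mset B \<subseteq> I \<Longrightarrow>
    free_fin_rank I (free_module B :: ('p::order, 'k::field, 'p \<times> nat \<Rightarrow> 'k) pmod)"
  unfolding free_fin_rank_def using pers_module_free_module is_barcode_free_module by blast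

lemma disjoint_mset_cancel:
  assumes "A + D = C + B" "set_mset A \<inter> set_mset B = {}" "set_mset C \<inter> set_mset D = {}"
  shows "A = C \<and> B = D"
proof -
  have "count A x = count C x \<and> count B x = count D x" for x
  proof -
    have "count A x + count D x = count C x + count B x"
      using assms(1) by (metis count_union)
    moreover have "count A x = 0 \<or> count B x = 0" "count C x = 0 \<or> count D x = 0"
      using assms(2,3) by (auto simp: disjoint_iff not_in_iff)
    ultimately show ?thesis by auto
  qed
  then show ?thesis by (auto simp: multiset_eq_iff)
qed

text \<open>
  The next two lemmas reduce the theorem to combinatorics: it remains to find two disjoint multisets
  whose counting functions differ by \<open>\<eta>\<close>.
\<close>

lemma minimal_hilbert_decomposition_unique:
  fixes P :: "('p::order, 'k::field, 'a::ab_group_add) pmod"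
    and Q :: "('p, 'k, 'b::ab_group_add) pmod"
  assumes C: "set_mset C \<subseteq> I" and D: "set_mset D \<subseteq> I" and CD: "set_mset C \<inter> set_mset D = {}"
    and \<eta>: "\<And>i. i \<in> I \<Longrightarrow> \<eta> i = int (count_below C i) - int (count_below D i)"
    and PQ: "minimal_hilbert_decomposition I \<eta> P Q"
  shows "pers_iso I P (free_module C :: ('p, 'k, 'p \<times> nat \<Rightarrow> 'k) pmod)"
    and "pers_iso I Q (free_module D :: ('p, 'k, 'p \<times> nat \<Rightarrow> 'k) pmod)"
proof -
  obtain A B where A: "pers_module I P" "is_barcode I P A" and B: "pers_module I Q" "is_barcode I Q B"
    using PQ
    unfolding minimal_hilbert_decomposition_def hilbert_decomposition_def free_fin_rank_def by blast
  have AB: "set_mset A \<inter> set_mset B = {}"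
    using PQ barcode_eq[OF A] barcode_eq[OF B] unfolding minimal_hilbert_decomposition_def by simp
  have "count_below (A + D) i = count_below (C + B) i" if "i \<in> I" for i
  proof -
    have "\<eta> i = Hil P i - Hil Q i"
      using PQ that unfolding minimal_hilbert_decomposition_def hilbert_decomposition_def by blast
    then show ?thesis
      using \<eta>[OF that] Hil_barcode[OF A that] Hil_barcode[OF B that] by (simp add: count_below_union)
  qed
  then have "A + D = C + B"
    using A(2) B(2) C D by (intro count_below_inject[of _ I]) (auto simp: is_barcode_def)
  then have "A = C" "B = D"
    using disjoint_mset_cancel AB CD by blast+
  then show "pers_iso I P (free_module C :: ('p, 'k, 'p \<times> nat \<Rightarrow> 'k) pmod)"
    and "pers_iso I Q (free_module D :: ('p, 'k, 'p \<times> nat \<Rightarrow> 'k) pmod)"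
    using A(2) B(2) by (auto simp: is_barcode_def)
qed

lemma minimal_hilbert_decomposition_free_modules:
  assumes C: "set_mset C \<subseteq> I" and D: "set_mset D \<subseteq> I" and CD: "set_mset C \<inter> set_mset D = {}"
    and \<eta>: "\<And>i. i \<in> I \<Longrightarrow> \<eta> i = int (count_below C i) - int (count_below D i)"
  shows "minimal_hilbert_decomposition I \<eta>
    (free_module C :: ('p::order, 'k::field, 'p \<times> nat \<Rightarrow> 'k) pmod)
    (free_module D :: ('p, 'k, 'p \<times> nat \<Rightarrow> 'k) pmod)"
proof -
  have "barcode I (free_module B :: ('p, 'k, 'p \<times> nat \<Rightarrow> 'k) pmod) = B" if "set_mset B \<subseteq> I" for B
    by (rule barcode_eq[OF pers_module_free_module is_barcode_free_module[OF that]])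
  then show ?thesis
    unfolding minimal_hilbert_decomposition_def hilbert_decomposition_def
    using C D CD \<eta> by (simp add: free_fin_rank_free_module Hil_free_module)
qed

section \<open>Structure maps between degrees above the same generators\<close>

text \<open>
  The structure map \<open>i \<rightarrow> j\<close> of \<open>free_module B\<close> is an inclusion of families, and under the hypothesis
  on \<open>B\<close> the supports allowed at \<open>i\<close> and at \<open>j\<close> agree; the isomorphism carries this over to \<open>P\<close>.
\<close>

lemma free_tr_bij:
  fixes P :: "('p::order, 'k::field, 'v::ab_group_add) pmod"
  assumes P: "pers_module I P" "is_barcode I P B" and ij: "i \<in> I" "j \<in> I" "i \<le> j"
    and same: "\<And>b. b \<in># B \<Longrightarrow> b \<le> j \<Longrightarrow> b \<le> i"
  shows "bij_betw (tr P i j) (spc P i) (spc P j)"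
proof -
  let ?F = "free_module B :: ('p, 'k, 'p \<times> nat \<Rightarrow> 'k) pmod"
  obtain f g where f: "pers_hom I P ?F f" and g: "pers_hom I ?F P g"
    and gf: "\<And>i x. i \<in> I \<Longrightarrow> x \<in> spc P i \<Longrightarrow> g i (f i x) = x"
    and fg: "\<And>i y. i \<in> I \<Longrightarrow> y \<in> spc ?F i \<Longrightarrow> f i (g i y) = y"
    using P(2) unfolding is_barcode_def pers_iso_def by blast
  have f_in: "f i x \<in> spc ?F i" if "i \<in> I" "x \<in> spc P i" for i x
    using pers_homD(2)[OF f] that .
  have g_in: "g i x \<in> spc P i" if "i \<in> I" "x \<in> spc ?F i" for i x
    using pers_homD(2)[OF g] that .
  have tr_in: "tr P i j x \<in> spc P j" if "x \<in> spc P i" for x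
    using pers_moduleD(3)[OF P(1) ij] that unfolding linear_between_def by blast
  have "live B i = live B j"
    using same ij(3) by (auto simp: live_def intro: order_trans) (metis count_inI not_less_zero)
  then have F: "spc ?F i = spc ?F j"
    by (simp add: spc_free_module)
  show ?thesis
  proof (rule bij_betw_byWitness[where f' = "\<lambda>y. g i (f j y)"])
    show "\<forall>x\<in>spc P i. g i (f j (tr P i j x)) = x"
      using pers_homD(3)[OF f ij] ij f_in gf by (simp add: tr_free_module_id)
    show "\<forall>y\<in>spc P j. tr P i j (g i (f j y)) = y"
    proof
      fix y assume y: "y \<in> spc P j"
      then have fy: "f j y \<in> spc ?F i" using f_in ij F by simp
      then have "tr P i j (g i (f j y)) = g j (tr ?F i j (f j y))"
        using pers_homD(3)[OF g ij] by simp
      then show "tr P i j (g i (f j y)) = y"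
        using fy gf[OF ij(2) y] by (simp add: tr_free_module_id)
    qed
  qed (use tr_in g_in f_in ij F in auto)
qed

lemma iso_to_cokerD:
  assumes "iso_to_coker I M P N f"
  shows "\<exists>\<theta>. (\<forall>i\<in>I. bij_betw (\<theta> i) {x +o f i ` spc P i |x. x \<in> spc N i} (spc M i)) \<and>
    (\<forall>i\<in>I. \<forall>x\<in>spc N i. \<forall>y\<in>spc N i.
      \<theta> i ((x + y) +o f i ` spc P i) = \<theta> i (x +o f i ` spc P i) + \<theta> i (y +o f i ` spc P i)) \<and>
    (\<forall>i\<in>I. \<forall>j\<in>I. i \<le> j \<longrightarrow> (\<forall>x\<in>spc N i.
      \<theta> j (tr N i j x +o f j ` spc P j) = tr M i j (\<theta> i (x +o f i ` spc P i))))"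
  using assms unfolding iso_to_coker_def Let_def by (elim ex_forward) simp

text \<open>
  A diagram chase: for injectivity, an element of the kernel lifts to some \<open>x \<in> N(i)\<close> that is mapped
  into the image of \<open>f j\<close>; pulling its preimage back along the surjection \<open>P(i) \<rightarrow> P(j)\<close> shows that \<open>x\<close> is
  in the image of \<open>f i\<close>, because \<open>N(i) \<rightarrow> N(j)\<close> is injective.
\<close>

lemma coker_tr_bij:
  assumes M: "pers_module I M" and P: "pers_module I P" and N: "pers_module I N"
    and f: "pers_hom I P N f" and co: "iso_to_coker I M P N f"
    and ij: "i \<in> I" "j \<in> I" "i \<le> j"
    and surjP: "spc P j \<subseteq> tr P i j ` spc P i" and bijN: "bij_betw (tr N i j) (spc N i) (spc N j)"
  shows "bij_betw (tr M i j) (spc M i) (spc M j)"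
proof -
  interpret M: vector_space "scl M" by (rule pers_moduleD(1)[OF M])
  interpret N: vector_space "scl N" by (rule pers_moduleD(1)[OF N])
  interpret P: vector_space "scl P" by (rule pers_moduleD(1)[OF P])
  define W where "W k = f k ` spc P k" for k
  obtain \<theta> where
    bij0: "\<forall>i\<in>I. bij_betw (\<theta> i) {x +o W i |x. x \<in> spc N i} (spc M i)"
    and add0: "\<forall>i\<in>I. \<forall>x\<in>spc N i. \<forall>y\<in>spc N i.
      \<theta> i ((x + y) +o W i) = \<theta> i (x +o W i) + \<theta> i (y +o W i)"
    and nat0: "\<forall>i\<in>I. \<forall>j\<in>I. i \<le> j \<longrightarrow>
      (\<forall>x\<in>spc N i. \<theta> j (tr N i j x +o W j) = tr M i j (\<theta> i (x +o W i)))"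
    using iso_to_cokerD[OF co, folded W_def] by (elim exE conjE)
  note bij = bij0[rule_format] and add = add0[rule_format]
  note nat = nat0[rule_format, OF ij]
  have inj\<theta>: "x +o W k = y +o W k"
    if "k \<in> I" "x \<in> spc N k" "y \<in> spc N k" "\<theta> k (x +o W k) = \<theta> k (y +o W k)" for k x y
    by (rule inj_onD[OF bij_betw_imp_inj_on[OF bij[OF that(1)]] that(4)]) (use that in blast)+
  have subM: "M.subspace (spc M k)" and subN: "N.subspace (spc N k)" and subP: "P.subspace (spc P k)"
    if "k \<in> I" for k
    using that pers_moduleD(2)[OF M] pers_moduleD(2)[OF N] pers_moduleD(2)[OF P] by blast+
  have lift: "\<exists>x\<in>spc N k. y = \<theta> k (x +o W k)" if "k \<in> I" "y \<in> spc M k" for k y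
    using bij[OF that(1)] that(2) unfolding bij_betw_def by (auto simp: image_iff)
  have flin: "f k ` spc P k \<subseteq> spc N k"
    "\<And>x y. x \<in> spc P k \<Longrightarrow> y \<in> spc P k \<Longrightarrow> f k (x + y) = f k x + f k y" if "k \<in> I" for k
    using pers_homD(1)[OF f that] unfolding linear_between_def by blast+
  have f0: "f k 0 = 0" if "k \<in> I" for k
    using flin(2)[OF that, of 0 0] P.subspace_0[OF subP[OF that]] by simp
  have W0: "0 \<in> W k" if "k \<in> I" for k
    unfolding W_def using f0[OF that] P.subspace_0[OF subP[OF that]] by force
  have \<theta>0: "\<theta> k (0 +o W k) = 0" if "k \<in> I" for k
    using add[OF that, of 0 0] N.subspace_0[OF subN[OF that]] by simp
  have absorb: "x +o W k = 0 +o W k" if k: "k \<in> I" and x: "x \<in> W k" for k x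
  proof -
    obtain p where p: "p \<in> spc P k" "x = f k p" using x unfolding W_def by blast
    have mp: "- p \<in> spc P k" using P.subspace_neg[OF subP[OF k] p(1)] .
    have fmp: "f k (- p) = - x"
      using flin(2)[OF k p(1) mp] f0[OF k] p(2) by (simp add: add_eq_0_iff)
    have "x + w \<in> W k" if w: "w \<in> W k" for w
    proof -
      obtain q where q: "q \<in> spc P k" "w = f k q" using w unfolding W_def by blast
      have "x + w = f k (p + q)" using flin(2)[OF k p(1) q(1)] p(2) q(2) by simp
      then show ?thesis unfolding W_def using P.subspace_add[OF subP[OF k] p(1) q(1)] by (rule image_eqI)
    qed
    moreover have "\<exists>v\<in>W k. w = x + v" if w: "w \<in> W k" for w
    proof -
      obtain q where q: "q \<in> spc P k" "w = f k q" using w unfolding W_def by blast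
      have "f k (- p + q) = - x + w"
        using flin(2)[OF k mp q(1)] fmp q(2) by simp
      moreover have "- p + q \<in> spc P k" using P.subspace_add[OF subP[OF k] mp q(1)] .
      ultimately have "- x + w \<in> W k" unfolding W_def by (metis image_eqI)
      then show ?thesis by (metis add_minus_cancel)
    qed
    ultimately show ?thesis by (auto simp: elt_set_plus_def)
  qed
  have trM: "linear_between (scl M) (scl M) (spc M i) (spc M j) (tr M i j)"
    by (rule pers_moduleD(3)[OF M ij])
  have surj: "tr M i j ` spc M i = spc M j"
  proof
    show "tr M i j ` spc M i \<subseteq> spc M j" using trM by (simp add: linear_between_def)
    show "spc M j \<subseteq> tr M i j ` spc M i"
    proof
      fix y assume "y \<in> spc M j"
      then obtain x where x: "x \<in> spc N j" "y = \<theta> j (x +o W j)" using lift[OF ij(2)] by blast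
      obtain x' where x': "x' \<in> spc N i" "x = tr N i j x'"
        using x(1) bijN unfolding bij_betw_def by blast
      then have "y = tr M i j (\<theta> i (x' +o W i))" using x nat by simp
      moreover have "\<theta> i (x' +o W i) \<in> spc M i"
        using bij[OF ij(1)] x'(1) unfolding bij_betw_def by blast
      ultimately show "y \<in> tr M i j ` spc M i" by blast
    qed
  qed
  have ker: "y = 0" if y: "y \<in> spc M i" and y0: "tr M i j y = 0" for y
  proof -
    obtain x where x: "x \<in> spc N i" "y = \<theta> i (x +o W i)" using lift[OF ij(1) y] by blast
    have tx: "tr N i j x \<in> spc N j" using bijN x(1) unfolding bij_betw_def by blast
    have "\<theta> j (tr N i j x +o W j) = \<theta> j (0 +o W j)"
      using nat[OF x(1)] x(2) y0 \<theta>0[OF ij(2)] by simp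
    then have "tr N i j x +o W j = 0 +o W j"
      by (rule inj\<theta>[OF ij(2) tx N.subspace_0[OF subN[OF ij(2)]]])
    then have "tr N i j x \<in> W j"
      using set_plus_intro2[OF W0[OF ij(2)], of "tr N i j x"] by (simp add: set_zero_plus)
    then obtain p where p: "p \<in> spc P j" "tr N i j x = f j p" unfolding W_def by blast
    obtain p' where p': "p' \<in> spc P i" "p = tr P i j p'" using p(1) surjP by blast
    have "tr N i j x = tr N i j (f i p')"
      using pers_homD(3)[OF f ij p'(1)] p(2) p'(2) by simp
    then have "x = f i p'"
      by (rule inj_onD[OF bij_betw_imp_inj_on[OF bijN]])
        (use x(1) flin(1)[OF ij(1)] p'(1) in auto)
    then have "x \<in> W i" using p'(1) unfolding W_def by blast
    then show ?thesis using absorb[OF ij(1)] \<theta>0[OF ij(1)] x(2) by simp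
  qed
  have "inj_on (tr M i j) (spc M i)"
  proof (rule inj_onI)
    fix x y assume xy: "x \<in> spc M i" "y \<in> spc M i" "tr M i j x = tr M i j y"
    have d: "x - y \<in> spc M i" using M.subspace_diff[OF subM[OF ij(1)] xy(1,2)] .
    have "tr M i j (x - y + y) = tr M i j (x - y) + tr M i j y"
      using trM d xy(2) unfolding linear_between_def by blast
    then have "tr M i j (x - y) = 0" using xy(3) by simp
    then show "x = y" using ker[OF d] by simp
  qed
  then show ?thesis using surj by (simp add: bij_betw_def)
qed

text \<open>
  The finite set \<open>S\<close> consists of the degrees of the generators and relations of a presentation.  If
  none of them is below \<open>i\<close>, then the module of generators, and with it \<open>M\<close>, vanishes at \<open>i\<close>.
\<close>

lemma Hil_constant_on_cells:
  fixes M :: "('p::order, 'k::field, 'v::ab_group_add) pmod"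
  assumes M: "pers_module I M" and fp: "finitely_presentable I M"
  shows "\<exists>S. finite S \<and> S \<subseteq> I \<and>
    (\<forall>i\<in>I. \<forall>j\<in>I. i \<le> j \<longrightarrow> (\<forall>s\<in>S. s \<le> j \<longrightarrow> s \<le> i) \<longrightarrow> Hil M i = Hil M j) \<and>
    (\<forall>i\<in>I. (\<forall>s\<in>S. \<not> s \<le> i) \<longrightarrow> Hil M i = 0)"
proof -
  obtain P N :: "('p, 'k, 'p \<times> nat \<Rightarrow> 'k) pmod" and f
    where "free_fin_rank I P" "free_fin_rank I N" and f: "pers_hom I P N f"
      and co: "iso_to_coker I M P N f"
    using fp unfolding finitely_presentable_def by (elim exE conjE)
  then obtain A B where P: "pers_module I P" "is_barcode I P A"
    and N: "pers_module I N" "is_barcode I N B"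
    unfolding free_fin_rank_def by blast
  interpret M: vector_space "scl M" by (rule pers_moduleD(1)[OF M])
  let ?S = "set_mset A \<union> set_mset B"
  show ?thesis
  proof (intro exI[of _ ?S] conjI ballI impI)
    show "finite ?S" by simp
    show "?S \<subseteq> I" using P N by (simp add: is_barcode_def)
  next
    fix i j assume ij: "i \<in> I" "j \<in> I" "i \<le> j" and "\<forall>s\<in>?S. s \<le> j \<longrightarrow> s \<le> i"
    then have same: "s \<le> i" if "s \<in> ?S" "s \<le> j" for s using that by blast
    have "bij_betw (tr P i j) (spc P i) (spc P j)"
      by (rule free_tr_bij[OF P ij]) (rule same, simp_all)
    then have surjP: "spc P j \<subseteq> tr P i j ` spc P i"
      by (simp add: bij_betw_imp_surj_on)
    have "bij_betw (tr N i j) (spc N i) (spc N j)"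
      by (rule free_tr_bij[OF N ij]) (rule same, simp_all)
    then have "bij_betw (tr M i j) (spc M i) (spc M j)"
      by (rule coker_tr_bij[OF M P(1) N(1) f co ij surjP])
    then have "M.dim (spc M i) = M.dim (spc M j)"
      by (rule dim_eq_of_linear_bij[OF pers_moduleD(1)[OF M] pers_moduleD(1)[OF M]
            pers_moduleD(2)[OF M ij(1)] pers_moduleD(3)[OF M ij]])
    then show "Hil M i = Hil M j" by (simp add: Hil_def)
  next
    fix i assume i: "i \<in> I" and none: "\<forall>s\<in>?S. \<not> s \<le> i"
    let ?F = "free_module B :: ('p, 'k, 'p \<times> nat \<Rightarrow> 'k) pmod"
    have "live B i = {}"
      using none by (auto simp: live_eq_Sigma)
    then have F: "spc ?F i = {0}" by (auto simp: spc_free_module fun_eq_iff)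
    obtain h g where h: "pers_hom I N ?F h"
      and gh: "\<forall>i\<in>I. (\<forall>x\<in>spc N i. g i (h i x) = x) \<and> (\<forall>y\<in>spc ?F i. h i (g i y) = y)"
      using N(2) unfolding is_barcode_def pers_iso_def by (elim exE conjE)
    have "x = g i 0" if "x \<in> spc N i" for x
    proof -
      have "h i x = 0" using pers_homD(2)[OF h i that] unfolding F by blast
      then show ?thesis using bspec[OF conjunct1[OF bspec[OF gh i]] that] by simp
    qed
    then have "spc N i \<subseteq> {g i 0}" by blast
    moreover obtain \<theta> where
      \<theta>: "\<forall>i\<in>I. bij_betw (\<theta> i) {x +o f i ` spc P i |x. x \<in> spc N i} (spc M i)"
      using iso_to_cokerD[OF co] by (elim exE conjE)
    have "\<theta> i ` {x +o f i ` spc P i |x. x \<in> spc N i} = spc M i"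
      using \<theta> i by (simp add: bij_betw_imp_surj_on)
    ultimately have "spc M i \<subseteq> {\<theta> i (g i 0 +o f i ` spc P i)}"
      by blast
    moreover have "0 \<in> spc M i"
      by (rule M.subspace_0[OF pers_moduleD(2)[OF M i]])
    ultimately have "spc M i = {0}" by (auto dest!: subset_singletonD)
    then show "Hil M i = 0"
      using M.dim_span_eq_card_independent[OF M.independent_empty] by (simp add: Hil_def)
  qed
qed

section \<open>Existence by Moebius inversion\<close>

text \<open>
  A maximal element \<open>m\<close> of \<open>T\<close> is below no other element, so after solving on \<open>T - {m}\<close> its weight can be
  chosen to make the equation at \<open>m\<close> true without disturbing the others.
\<close>

lemma moebius_inversion_finite:
  fixes h :: "'p::order \<Rightarrow> 'a::ab_group_add"
  assumes "finite T"
  shows "\<exists>c. \<forall>t\<in>T. h t = (\<Sum>u | u \<in> T \<and> u \<le> t. c u)"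
  using assms
proof (induction "card T" arbitrary: T)
  case 0
  then show ?case by simp
next
  case (Suc n)
  then have "T \<noteq> {}" by auto
  then obtain m where m: "m \<in> T" "\<And>b. b \<in> T \<Longrightarrow> m \<le> b \<Longrightarrow> m = b"
    using finite_has_maximal[OF Suc.prems] by blast
  obtain c where c: "\<And>t. t \<in> T - {m} \<Longrightarrow> h t = (\<Sum>u | u \<in> T - {m} \<and> u \<le> t. c u)"
  proof -
    have "n = card (T - {m})" using Suc.hyps(2) Suc.prems m(1) by simp
    from Suc.hyps(1)[OF this] Suc.prems show thesis using that by blast
  qed
  let ?U = "{u. u \<in> T - {m} \<and> u \<le> m}"
  define c' where "c' = c(m := h m - (\<Sum>u\<in>?U. c u))"
  have "h t = (\<Sum>u | u \<in> T \<and> u \<le> t. c' u)" if t: "t \<in> T" for t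
  proof (cases "t = m")
    case True
    have "{u. u \<in> T \<and> u \<le> m} = insert m ?U" using m(1) by auto
    then have "(\<Sum>u | u \<in> T \<and> u \<le> m. c' u) = c' m + (\<Sum>u\<in>?U. c' u)"
      using Suc.prems by simp
    also have "(\<Sum>u\<in>?U. c' u) = (\<Sum>u\<in>?U. c u)"
      by (rule sum.cong) (auto simp: c'_def)
    finally show ?thesis by (simp add: True c'_def)
  next
    case False
    then have "{u. u \<in> T \<and> u \<le> t} = {u. u \<in> T - {m} \<and> u \<le> t}"
      using m(2)[OF t] by auto
    then have "(\<Sum>u | u \<in> T \<and> u \<le> t. c' u) = (\<Sum>u | u \<in> T - {m} \<and> u \<le> t. c' u)"
      by simp
    also have "\<dots> = (\<Sum>u | u \<in> T - {m} \<and> u \<le> t. c u)"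
      by (rule sum.cong) (auto simp: c'_def)
    finally show ?thesis using c[of t] t False by simp
  qed
  then show ?case by blast
qed

lemma integer_weights_eq_count_below_diff:
  fixes c :: "'p::order \<Rightarrow> int"
  assumes "finite T"
  obtains C D where "set_mset C \<subseteq> T" "set_mset D \<subseteq> T" "set_mset C \<inter> set_mset D = {}"
    and "\<And>i. (\<Sum>t | t \<in> T \<and> t \<le> i. c t) = int (count_below C i) - int (count_below D i)"
proof -
  have ex: "\<exists>B. \<forall>t. count B t = (if t \<in> T then w t else 0)" for w :: "'p \<Rightarrow> nat"
  proof (intro exI allI)
    fix t
    show "count (\<Sum>u\<in>T. replicate_mset (w u) u) t = (if t \<in> T then w t else 0)"
      using assms by (simp add: count_sum sum.delta)
  qed
  obtain C where C: "\<And>t. count C t = (if t \<in> T then nat (c t) else 0)"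
    using ex[of "\<lambda>t. nat (c t)"] by blast
  obtain D where D: "\<And>t. count D t = (if t \<in> T then nat (- c t) else 0)"
    using ex[of "\<lambda>t. nat (- c t)"] by blast
  have CD: "set_mset C \<subseteq> T" "set_mset D \<subseteq> T"
    by (metis C D not_in_iff subsetI)+
  show thesis
  proof
    show "set_mset C \<inter> set_mset D = {}"
      using C D by (auto simp flip: count_greater_zero_iff split: if_splits)
    fix i
    have "int (count_below C i) - int (count_below D i) =
        (\<Sum>t | t \<in> T \<and> t \<le> i. int (count C t) - int (count D t))"
      by (simp add: count_below_sum[OF assms CD(1)] count_below_sum[OF assms CD(2)] sum_subtractf)
    also have "\<dots> = (\<Sum>t | t \<in> T \<and> t \<le> i. c t)"
      by (rule sum.cong) (auto simp: C D)
    finally show "(\<Sum>t | t \<in> T \<and> t \<le> i. c t) = int (count_below C i) - int (count_below D i)"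
      by simp
  qed (use CD in auto)
qed

lemma Hil_eq_count_below_diff:
  fixes M :: "('p::semilattice_sup, 'k::field, 'v::ab_group_add) pmod"
  assumes sup: "\<And>x y. x \<in> I \<Longrightarrow> y \<in> I \<Longrightarrow> sup x y \<in> I"
    and M: "pers_module I M" and fp: "finitely_presentable I M"
  obtains C D where "set_mset C \<subseteq> I" "set_mset D \<subseteq> I" "set_mset C \<inter> set_mset D = {}"
    and "\<And>i. i \<in> I \<Longrightarrow> Hil M i = int (count_below C i) - int (count_below D i)"
proof -
  obtain S where S: "finite S" "S \<subseteq> I"
    and const: "\<forall>i\<in>I. \<forall>j\<in>I. i \<le> j \<longrightarrow> (\<forall>s\<in>S. s \<le> j \<longrightarrow> s \<le> i) \<longrightarrow> Hil M i = Hil M j"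
    and zero: "\<forall>i\<in>I. (\<forall>s\<in>S. \<not> s \<le> i) \<longrightarrow> Hil M i = 0"
    using Hil_constant_on_cells[OF M fp] by (elim exE conjE)
  define T where "T = Sup_fin ` (Pow S - {{}})"
  have T: "finite T" using S(1) by (simp add: T_def)
  have Sup_I: "Sup_fin X \<in> I" if "finite X" "X \<noteq> {}" "X \<subseteq> I" for X
    using that by (induction rule: finite_ne_induct) (auto intro: sup)
  have TI: "T \<subseteq> I"
  proof
    fix t assume "t \<in> T"
    then obtain Y where Y: "Y \<subseteq> S" "Y \<noteq> {}" "t = Sup_fin Y" unfolding T_def by blast
    show "t \<in> I"
      unfolding Y(3) using Y(1,2) S by (intro Sup_I) (auto intro: finite_subset)
  qed
  obtain c where c: "\<And>t. t \<in> T \<Longrightarrow> Hil M t = (\<Sum>u | u \<in> T \<and> u \<le> t. c u)"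
    using moebius_inversion_finite[OF T, of "Hil M"] by blast
  have sum: "Hil M i = (\<Sum>u | u \<in> T \<and> u \<le> i. c u)" if i: "i \<in> I" for i
  proof -
    let ?X = "{s \<in> S. s \<le> i}"
    have X: "finite ?X" using S(1) by simp
    \<comment> \<open>Hence the elements of \<open>T\<close> below \<open>i\<close> are those below the join of \<open>?X\<close>, if \<open>?X\<close> is nonempty.\<close>
    have below: "\<exists>Y. Y \<noteq> {} \<and> Y \<subseteq> ?X \<and> u = Sup_fin Y" if u: "u \<in> T" "u \<le> i" for u
    proof -
      obtain Y where Y: "Y \<subseteq> S" "Y \<noteq> {}" "u = Sup_fin Y" using u(1) unfolding T_def by blast
      have "finite Y" using Y(1) S(1) by (rule finite_subset)
      then have "y \<le> i" if "y \<in> Y" for y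
        using Sup_fin.coboundedI[of Y y] that u(2) Y(3) by simp
      then have "Y \<subseteq> ?X"
        using Y(1) by blast
      with Y(2,3) show ?thesis by (intro exI[of _ Y] conjI)
    qed
    show ?thesis
    proof (cases "?X = {}")
      case True
      have none: "\<not> u \<le> i" if "u \<in> T" for u
        using below[OF that] True by blast
      have "(\<Sum>u | u \<in> T \<and> u \<le> i. c u) = 0" using none by (intro sum.neutral) blast
      moreover have "Hil M i = 0" using bspec[OF zero i] True by blast
      ultimately show ?thesis by simp
    next
      case False
      let ?j = "Sup_fin ?X"
      have jT: "?j \<in> T" using False by (auto simp: T_def)
      have ji: "?j \<le> i" using X False by (intro Sup_fin.boundedI) auto
      have "Hil M ?j = Hil M i"
      proof (rule const[rule_format])
        show "?j \<in> I" using jT TI by blast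
        show "s \<le> ?j" if "s \<in> S" "s \<le> i" for s
          using that by (intro Sup_fin.coboundedI[OF X]) simp
      qed (rule i ji)+
      moreover have "{u. u \<in> T \<and> u \<le> ?j} = {u. u \<in> T \<and> u \<le> i}"
      proof -
        have "u \<le> ?j" if u: "u \<in> T" "u \<le> i" for u
        proof -
          obtain Y where Y: "Y \<noteq> {}" "Y \<subseteq> ?X" "u = Sup_fin Y" using below[OF u] by blast
          show ?thesis unfolding Y(3) using Y(1,2) X by (intro Sup_fin.subset_imp)
        qed
        moreover have "u \<le> i" if "u \<le> ?j" for u using that ji by (rule order_trans)
        ultimately show ?thesis by blast
      qed
      ultimately show ?thesis using c[OF jT] by simp
    qed
  qed
  obtain C D where CD: "set_mset C \<subseteq> T" "set_mset D \<subseteq> T" "set_mset C \<inter> set_mset D = {}"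
    and diff: "\<And>i. (\<Sum>t | t \<in> T \<and> t \<le> i. c t) = int (count_below C i) - int (count_below D i)"
    using integer_weights_eq_count_below_diff[OF T, of c] by blast
  show thesis
  proof (rule that[of C D])
    show "Hil M i = int (count_below C i) - int (count_below D i)" if "i \<in> I" for i
      unfolding sum[OF that] by (rule diff)
  qed (use CD TI in blast)+
qed

lemma Rn_sup_closed: "x \<in> Rn n \<Longrightarrow> y \<in> Rn n \<Longrightarrow> sup x y \<in> Rn n"
  by (auto simp: Rn_def PiE_iff extensional_def)

theorem proposition5p2:
  fixes n :: nat
    and M :: "(nat \<Rightarrow> real, 'k::field, 'v::ab_group_add) pmod"
  assumes "pers_module (Rn n) M"
    and "finitely_presentable (Rn n) M"
  shows "\<exists>(P' :: (nat \<Rightarrow> real, 'k, (nat \<Rightarrow> real) \<times> nat \<Rightarrow> 'k) pmod)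
          (Q' :: (nat \<Rightarrow> real, 'k, (nat \<Rightarrow> real) \<times> nat \<Rightarrow> 'k) pmod).
    minimal_hilbert_decomposition (Rn n) (Hil M) P' Q' \<and>
    (\<forall>(P :: (nat \<Rightarrow> real, 'k, 'a::ab_group_add) pmod)
      (Q :: (nat \<Rightarrow> real, 'k, 'b::ab_group_add) pmod).
      minimal_hilbert_decomposition (Rn n) (Hil M) P Q \<longrightarrow>
      pers_iso (Rn n) P P' \<and> pers_iso (Rn n) Q Q')"
proof -
  obtain C D where CD: "set_mset C \<subseteq> Rn n" "set_mset D \<subseteq> Rn n" "set_mset C \<inter> set_mset D = {}"
    "\<And>i. i \<in> Rn n \<Longrightarrow> Hil M i = int (count_below C i) - int (count_below D i)"
    using Hil_eq_count_below_diff[OF Rn_sup_closed assms] by metis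
  show ?thesis
    by (intro exI[of _ "free_module C"] exI[of _ "free_module D"] conjI allI impI
        minimal_hilbert_decomposition_free_modules[OF CD]
        minimal_hilbert_decomposition_unique[OF CD])
qed

end
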